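(* Let $A_1,A_2$ be two points in the projective plane and, for $i\in\{1,2\}$, let $(a_{i1}a_{i2};b_{i1}b_{i2})$ be a harmonic pencil of lines at the point $A_i$. If three of the four points $$a_{11}\times a_{21},\quad a_{12}\times a_{22},\quad b_{11}\times b_{21},\quad b_{12}\times b_{22}$$ are collinear, then all four points are collinear.
   Context: The setting is the real projective plane. For distinct lines $g,h$, $g\times h$ denotes their intersection point (whenever this notation is used the two lines are understood to be distinct). A harmonic pencil $(gh;uv)$ at a point $A$ consists of four distinct lines $g,h,u,v$ through $A$ such that $v$ is the harmonic conjugate of $u$ with respect to $g$ and $h$ (cross-ratio $-1$ in the classical normalization). *)

theory Defs
  imports "HOL-Analysis.Analysis"
begin

text \<open>
  The real projective plane is modelled on the linear subspaces of \<open>real ^ 3\<close>: points are the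
  subspaces of dimension 1, lines those of dimension 2, and a point \<open>A\<close> is incident with a
  line \<open>g\<close> iff \<open>A \<subseteq> g\<close>.
\<close>

definition proj_point :: "(real ^ 3) set \<Rightarrow> bool" where
  "proj_point A \<longleftrightarrow> subspace A \<and> dim A = 1"

definition proj_line :: "(real ^ 3) set \<Rightarrow> bool" where
  "proj_line g \<longleftrightarrow> subspace g \<and> dim g = 2"

definition proj_collinear :: "(real ^ 3) set set \<Rightarrow> bool" where
  "proj_collinear S \<longleftrightarrow> (\<exists>l. proj_line l \<and> (\<forall>P\<in>S. P \<subseteq> l))"

text \<open>The intersection point of two lines; meaningful only if the lines are distinct.\<close>

definition meet :: "(real ^ 3) set \<Rightarrow> (real ^ 3) set \<Rightarrow> (real ^ 3) set" where
  "meet g h = g \<inter> h"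

text \<open>
  The lines through a point \<open>A\<close> form a projective line, namely that of the one-dimensional
  subspaces of the quotient of \<open>real ^ 3\<close> by \<open>A\<close>. If \<open>p\<close> spans \<open>A\<close>, then
  \<open>(x, y) \<mapsto> det (vector [p, x, y])\<close> induces a nondegenerate alternating form on this
  two-dimensional quotient. The cross-ratio of four lines \<open>g, h, u, v\<close> through \<open>A\<close> is computed
  with this form from vectors \<open>x, y, z, w\<close> that represent the lines; it is
  \<open>[x,z] [y,w] / ([x,w] [y,z])\<close> with \<open>[x,y]\<close> denoting the form. In an affine coordinate on the
  pencil this is \<open>(u - g) (v - h) / ((v - g) (u - h))\<close>, so it equals \<open>-1\<close> if \<open>z = x + y\<close> and
  \<open>w = x - y\<close>. Lemma \<open>cross_ratio_eq\<close> below states that no choice of representatives matters.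
\<close>

definition cross_ratio ::
  "(real ^ 3) set \<Rightarrow> (real ^ 3) set \<Rightarrow> (real ^ 3) set \<Rightarrow> (real ^ 3) set \<Rightarrow> (real ^ 3) set \<Rightarrow> real" where
  "cross_ratio A g h u v =
    (THE r. \<exists>p \<in> A - {0}. \<exists>x \<in> g - A. \<exists>y \<in> h - A. \<exists>z \<in> u - A. \<exists>w \<in> v - A.
       r = det (vector [p, x, z]) * det (vector [p, y, w])
         / (det (vector [p, x, w]) * det (vector [p, y, z])))"

definition harmonic_conjugate ::
  "(real ^ 3) set \<Rightarrow> (real ^ 3) set \<Rightarrow> (real ^ 3) set \<Rightarrow> (real ^ 3) set \<Rightarrow> (real ^ 3) set \<Rightarrow> bool" where
  "harmonic_conjugate A g h u v \<longleftrightarrow> cross_ratio A g h u v = - 1"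

text \<open>\<open>harmonic_pencil A g h u v\<close> stands for the harmonic pencil \<open>(gh;uv)\<close> at \<open>A\<close>.\<close>

definition harmonic_pencil ::
  "(real ^ 3) set \<Rightarrow> (real ^ 3) set \<Rightarrow> (real ^ 3) set \<Rightarrow> (real ^ 3) set \<Rightarrow> (real ^ 3) set \<Rightarrow> bool" where
  "harmonic_pencil A g h u v \<longleftrightarrow>
     proj_point A \<and> (\<forall>l \<in> {g, h, u, v}. proj_line l \<and> A \<subseteq> l) \<and>
     distinct [g, h, u, v] \<and> harmonic_conjugate A g h u v"

lemma dim_eq_imp_eq:
  fixes S T :: "(real ^ 3) set"
  assumes "subspace S" "subspace T" "S \<subseteq> T" "dim T \<le> dim S"
  shows "S = T"
  using subspace_dim_equal assms by blast

lemma proj_point_meet: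
  assumes "proj_line g" "proj_line h" "g \<noteq> h"
  shows "proj_point (meet g h)"
proof -
  have sub: "subspace g" "subspace h" and d: "dim g = 2" "dim h = 2"
    using assms by (auto simp: proj_line_def)
  let ?S = "{x + y |x y. x \<in> g \<and> y \<in> h}"
  have eq: "dim ?S + dim (g \<inter> h) = dim g + dim h"
    using dim_sums_Int[OF sub] by simp
  have "dim ?S \<le> 3"
    using dim_subset_UNIV[of ?S] by simp
  moreover have "dim (g \<inter> h) \<noteq> 2"
  proof
    assume "dim (g \<inter> h) = 2"
    then have "g \<inter> h = g" "g \<inter> h = h"
      using dim_eq_imp_eq[of "g \<inter> h" g] dim_eq_imp_eq[of "g \<inter> h" h] sub d
        subspace_inter[OF sub] by (metis Int_lower1 order_refl, metis Int_lower2 order_refl)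
    then show False using assms(3) by simp
  qed
  moreover have "dim (g \<inter> h) \<le> 2"
    using dim_subset[of "g \<inter> h" g] d by simp
  ultimately have "dim (g \<inter> h) = 1"
    using eq d by simp
  then show ?thesis
    using sub by (simp add: proj_point_def meet_def subspace_inter)
qed

lemma meet_unique:
  assumes "proj_line g" "proj_line h" "g \<noteq> h" "proj_point P" "P \<subseteq> g" "P \<subseteq> h"
  shows "P = meet g h"
proof (rule dim_eq_imp_eq)
  show "P \<subseteq> meet g h"
    using assms by (simp add: meet_def)
qed (use assms proj_point_meet in \<open>auto simp: proj_point_def\<close>)

lemma proj_line_representatives:
  assumes A: "proj_point A" and p: "p \<in> A - {0}"
    and g: "proj_line g" "A \<subseteq> g" and x: "x \<in> g - A" "x' \<in> g - A"
  obtains c d where "c \<noteq> 0" "x' = c *\<^sub>R x + d *\<^sub>R p"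
proof -
  have "span {p} = A"
  proof (rule dim_eq_imp_eq)
    show "span {p} \<subseteq> A"
      using A p by (intro span_minimal) (auto simp: proj_point_def)
    show "dim A \<le> dim (span {p})"
      using A p by (simp add: proj_point_def)
  qed (use A in \<open>auto simp: proj_point_def\<close>)
  have ind: "independent {x, p}"
    using p x(1) \<open>span {p} = A\<close> by (simp add: independent_insert)
  have "x \<noteq> p"
    using p x(1) by auto
  have "span {x, p} = g"
  proof (rule dim_eq_imp_eq)
    show "span {x, p} \<subseteq> g"
      using p x(1) g by (intro span_minimal) (auto simp: proj_line_def)
    show "dim g \<le> dim (span {x, p})"
      using g dim_eq_card_independent[OF ind] \<open>x \<noteq> p\<close> by (simp add: proj_line_def)
  qed (use g in \<open>auto simp: proj_line_def\<close>)
  then have "x' \<in> span {x, p}"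
    using x(2) by simp
  then obtain c where "x' - c *\<^sub>R x \<in> span {p}"
    using span_breakdown_eq by blast
  then obtain d where d: "x' - c *\<^sub>R x = d *\<^sub>R p"
    by (auto simp: span_singleton)
  have "c \<noteq> 0"
  proof
    assume "c = 0"
    then have "x' \<in> span {p}"
      using d by (simp add: span_mul span_base)
    then show False using x(2) \<open>span {p} = A\<close> by simp
  qed
  then show ?thesis
    using that d by (metis add.commute diff_add_cancel)
qed

lemma det_representatives:
  fixes p x y :: "real ^ 3"
  shows "det (vector [k *\<^sub>R p, c *\<^sub>R x + d *\<^sub>R p, c' *\<^sub>R y + d' *\<^sub>R p] :: real ^ 3 ^ 3)
       = k * c * c' * det (vector [p, x, y])"
  by (simp add: det_3 algebra_simps)

lemma cross_ratio_eq:
  assumes A: "proj_point A"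
    and lines: "\<forall>l \<in> {g, h, u, v}. proj_line l \<and> A \<subseteq> l"
    and mem: "p \<in> A - {0}" "x \<in> g - A" "y \<in> h - A" "z \<in> u - A" "w \<in> v - A"
  shows "cross_ratio A g h u v =
         det (vector [p, x, z]) * det (vector [p, y, w])
         / (det (vector [p, x, w]) * det (vector [p, y, z]))"
  unfolding cross_ratio_def
proof (rule the_equality)
  show "\<exists>p' \<in> A - {0}. \<exists>x' \<in> g - A. \<exists>y' \<in> h - A. \<exists>z' \<in> u - A. \<exists>w' \<in> v - A.
      det (vector [p, x, z]) * det (vector [p, y, w])
        / (det (vector [p, x, w]) * det (vector [p, y, z]))
      = det (vector [p', x', z']) * det (vector [p', y', w'])
        / (det (vector [p', x', w']) * det (vector [p', y', z']))"
    using mem by blast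
next
  fix r
  assume "\<exists>p \<in> A - {0}. \<exists>x \<in> g - A. \<exists>y \<in> h - A. \<exists>z \<in> u - A. \<exists>w \<in> v - A.
      r = det (vector [p, x, z]) * det (vector [p, y, w])
        / (det (vector [p, x, w]) * det (vector [p, y, z]))"
  then obtain p' x' y' z' w' where mem':
      "p' \<in> A - {0}" "x' \<in> g - A" "y' \<in> h - A" "z' \<in> u - A" "w' \<in> v - A"
    and r: "r = det (vector [p', x', z']) * det (vector [p', y', w'])
        / (det (vector [p', x', w']) * det (vector [p', y', z']))"
    by blast
  have "span {p} = A"
  proof (rule dim_eq_imp_eq)
    show "span {p} \<subseteq> A"
      using A mem(1) by (intro span_minimal) (auto simp: proj_point_def)
    show "dim A \<le> dim (span {p})"
      using A mem(1) by (simp add: proj_point_def)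
  qed (use A in \<open>auto simp: proj_point_def\<close>)
  then obtain k where p': "p' = k *\<^sub>R p"
    using mem'(1) by (auto simp: span_singleton)
  then have "k \<noteq> 0"
    using mem'(1) by auto
  obtain c1 d1 where 1: "c1 \<noteq> 0" "x' = c1 *\<^sub>R x + d1 *\<^sub>R p"
    using proj_line_representatives[OF A mem(1) _ _ mem(2) mem'(2)] lines by auto
  obtain c2 d2 where 2: "c2 \<noteq> 0" "y' = c2 *\<^sub>R y + d2 *\<^sub>R p"
    using proj_line_representatives[OF A mem(1) _ _ mem(3) mem'(3)] lines by auto
  obtain c3 d3 where 3: "c3 \<noteq> 0" "z' = c3 *\<^sub>R z + d3 *\<^sub>R p"
    using proj_line_representatives[OF A mem(1) _ _ mem(4) mem'(4)] lines by auto
  obtain c4 d4 where 4: "c4 \<noteq> 0" "w' = c4 *\<^sub>R w + d4 *\<^sub>R p"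
    using proj_line_representatives[OF A mem(1) _ _ mem(5) mem'(5)] lines by auto
  show "r = det (vector [p, x, z]) * det (vector [p, y, w])
        / (det (vector [p, x, w]) * det (vector [p, y, z]))"
    unfolding r p' 1(2) 2(2) 3(2) 4(2) det_representatives
    using \<open>k \<noteq> 0\<close> 1(1) 2(1) 3(1) 4(1) by (simp add: divide_simps)
qed

end

theory Submission
  imports Defs
begin

text \<open>
  Describe lines by normal vectors. A harmonic pencil then has normals \<open>n, m, n + m, n - m\<close>,
  and the intersection of two lines is spanned by the cross product of their normals. With normals
  \<open>n, m\<close> at \<open>A1\<close> and \<open>n', m'\<close> at \<open>A2\<close>, the four points are spanned by \<open>N = n \<times> n'\<close>,
  \<open>M = m \<times> m'\<close>, \<open>N + M + X\<close> and \<open>N + M - X\<close>, where \<open>X = n \<times> m' + m \<times> n'\<close>.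
  A subspace that contains three of these vectors contains the fourth.
\<close>

lemma dot_cross_eq_det:
  fixes p x y :: "real ^ 3"
  shows "cross3 p x \<bullet> y = det (vector [p, x, y])"
  by (metis dot_cross_det cross_triple inner_commute)

lemma proj_line_orthogonal:
  assumes "n \<noteq> 0"
  shows "proj_line {v. n \<bullet> v = 0}"
  using assms by (simp add: proj_line_def subspace_hyperplane dim_hyperplane)

text \<open>Modulo \<open>p\<close>, the plane \<open>g\<close> is generated by \<open>x\<close>, so
  \<open>cross3 p x\<close> annihilates all of \<open>g\<close>; equality follows by comparing
  dimensions.\<close>

lemma proj_line_eq_orthogonal_cross3:
  assumes A: "proj_point A" and p: "p \<in> A - {0}"
    and g: "proj_line g" "A \<subseteq> g" and x: "x \<in> g - A"
  shows "cross3 p x \<noteq> 0" "g = {v. cross3 p x \<bullet> v = 0}"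
proof -
  have subA: "subspace A"
    using A by (simp add: proj_point_def)
  show nz: "cross3 p x \<noteq> 0"
  proof
    assume "cross3 p x = 0"
    then obtain c where "x = c *\<^sub>R p"
      using p by (auto simp: cross_eq_0 collinear_lemma)
    then show False
      using x p subA by (simp add: subspace_scale)
  qed
  have outside: "cross3 p x \<bullet> v = 0" if v: "v \<in> g - A" for v
  proof -
    obtain c d where "v = c *\<^sub>R x + d *\<^sub>R p"
      using proj_line_representatives[OF A p g x v] by metis
    then show ?thesis
      by (simp add: inner_add_right dot_cross_self)
  qed
  have "cross3 p x \<bullet> v = 0" if v: "v \<in> A" for v
  proof -
    \<comment> \<open>Representatives only describe vectors outside \<open>A\<close>, so
      \<open>v\<close> is reached as the difference of \<open>x + v\<close> and \<open>x\<close>,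
      both outside \<open>A\<close>.\<close>
    have "x + v \<in> g - A"
    proof -
      have "x + v \<in> g"
        using v x g by (auto simp: proj_line_def intro: subspace_add)
      moreover have "x + v \<notin> A"
        using subspace_diff[OF subA, of "x + v" v] v x by auto
      ultimately show ?thesis by simp
    qed
    then show ?thesis
      using outside by (force simp: inner_add_right dot_cross_self)
  qed
  then have "g \<subseteq> {v. cross3 p x \<bullet> v = 0}"
    using outside by blast
  then show "g = {v. cross3 p x \<bullet> v = 0}"
    using g proj_line_orthogonal[OF nz] by (intro dim_eq_imp_eq) (auto simp: proj_line_def)
qed

text \<open>This is Cramer's rule for expressing \<open>z\<close> through \<open>x\<close> and
  \<open>y\<close> modulo \<open>p\<close>, transported by the map \<open>cross3 p\<close>, which
  kills \<open>p\<close>.\<close>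

lemma det_scaleR_cross3:
  fixes p x y z :: "real ^ 3"
  shows "det (vector [p, x, y]) *\<^sub>R cross3 p z
       = det (vector [p, z, y]) *\<^sub>R cross3 p x + det (vector [p, x, z]) *\<^sub>R cross3 p y"
  by (simp add: det_3 cross3_def vec_eq_iff forall_3 algebra_simps)

text \<open>Normals of \<open>g\<close> and \<open>h\<close> can be scaled so that their sum is
  normal to \<open>u\<close>; cross-ratio \<open>-1\<close> then says exactly that their difference
  is normal to \<open>v\<close>.\<close>

lemma harmonic_pencil_normals:
  assumes "harmonic_pencil A g h u v"
  obtains n m where "n \<noteq> 0" "m \<noteq> 0" "n + m \<noteq> 0" "n - m \<noteq> 0"
    "g = {x. n \<bullet> x = 0}" "h = {x. m \<bullet> x = 0}"
    "u = {x. (n + m) \<bullet> x = 0}" "v = {x. (n - m) \<bullet> x = 0}"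
proof -
  have A: "proj_point A" and lines: "\<forall>l \<in> {g, h, u, v}. proj_line l \<and> A \<subseteq> l"
    and dist: "distinct [g, h, u, v]" and cr: "cross_ratio A g h u v = -1"
    using assms by (auto simp: harmonic_pencil_def harmonic_conjugate_def)
  have "A \<noteq> {0}"
    using A by (auto simp: proj_point_def)
  then obtain p where p: "p \<in> A - {0}"
    using A subspace_0 by (fastforce simp: proj_point_def)
  have ex: "\<exists>x. x \<in> l - A" if "l \<in> {g, h, u, v}" for l
  proof -
    have "l \<noteq> A"
      using that lines A by (auto simp: proj_line_def proj_point_def)
    then show ?thesis
      using that lines by blast
  qed
  obtain x y z w where mem: "x \<in> g - A" "y \<in> h - A" "z \<in> u - A" "w \<in> v - A"
    using ex[of g] ex[of h] ex[of u] ex[of v] by auto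
  let ?D = "\<lambda>x y. det (vector [p, x, y] :: real ^ 3 ^ 3)"
  have swap: "?D b a = - ?D a b" for a b
    by (simp add: det_3)
  have normal: "cross3 p a \<noteq> 0 \<and> l = {v. cross3 p a \<bullet> v = 0}"
    if "l \<in> {g, h, u, v}" "a \<in> l - A" for l a
  proof -
    have "proj_line l" "A \<subseteq> l"
      using that(1) lines by auto
    from proj_line_eq_orthogonal_cross3[OF A p this that(2)] show ?thesis ..
  qed
  have "?D x z * ?D y w / (?D x w * ?D y z) = -1"
    using cross_ratio_eq[OF A lines p mem] cr by simp
  \<comment> \<open>Since division by zero yields \<open>0\<close>, the value \<open>-1\<close>
    forces every factor of the quotient to be nonzero.\<close>
  then have nz: "?D x z \<noteq> 0" "?D y w \<noteq> 0" "?D y z \<noteq> 0"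
    and harm: "?D x z * ?D y w = - (?D x w * ?D y z)"
    by (auto simp: divide_simps split: if_splits)
  \<comment> \<open>This determinant does not occur in the cross-ratio. Its vanishing would put
    \<open>y\<close> into the intersection of \<open>g\<close> and \<open>h\<close>, which is
    \<open>A\<close>.\<close>
  have "?D x y \<noteq> 0"
  proof
    assume "?D x y = 0"
    then have "y \<in> g"
      using normal[of g x] mem by (simp add: dot_cross_eq_det)
    moreover have "proj_point (meet g h)" "A = meet g h"
      using proj_point_meet[of g h] meet_unique[of g h A] lines dist A by auto
    ultimately show False
      using mem by (auto simp: meet_def)
  qed
  \<comment> \<open>The weights are the Cramer coefficients of \<open>z\<close>, which makes
    \<open>n + m\<close> a multiple of \<open>cross3 p z\<close>.\<close>
  define n where "n = ?D z y *\<^sub>R cross3 p x"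
  define m where "m = ?D x z *\<^sub>R cross3 p y"
  have sum: "n + m = ?D x y *\<^sub>R cross3 p z"
    unfolding n_def m_def by (rule det_scaleR_cross3[symmetric])
  \<comment> \<open>Expand \<open>cross3 p w\<close> by Cramer's rule: the terms in
    \<open>cross3 p x\<close> agree, and those in \<open>cross3 p y\<close> agree by
    harmonicity.\<close>
  have "?D w y *\<^sub>R (n - m) = ?D z y *\<^sub>R (?D x y *\<^sub>R cross3 p w)"
  proof -
    have "?D w y * ?D x z = - (?D z y * ?D x w)"
      using harm swap[of w y] swap[of z y] by (simp add: algebra_simps)
    then show ?thesis
      unfolding det_scaleR_cross3[of p x y w] n_def m_def
      by (simp add: scaleR_diff_right scaleR_add_right mult.commute)
  qed
  then have "(1 / ?D w y) *\<^sub>R (?D w y *\<^sub>R (n - m))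
      = (?D z y * ?D x y / ?D w y) *\<^sub>R cross3 p w"
    by simp
  then have "n - m = (?D z y * ?D x y / ?D w y) *\<^sub>R cross3 p w"
    using nz(2) swap[of w y] by simp
  moreover have "?D z y * ?D x y / ?D w y \<noteq> 0"
    using nz swap[of w y] swap[of z y] \<open>?D x y \<noteq> 0\<close> by simp
  ultimately obtain c where diff: "c \<noteq> 0" "n - m = c *\<^sub>R cross3 p w"
    by blast
  have scaled: "c *\<^sub>R cross3 p a \<noteq> 0 \<and> l = {v. (c *\<^sub>R cross3 p a) \<bullet> v = 0}"
    if "c \<noteq> 0" "l \<in> {g, h, u, v}" "a \<in> l - A" for c l a
    using normal[OF that(2,3)] that(1) by simp
  have zy: "?D z y \<noteq> 0"
    using nz swap[of z y] by simp
  show ?thesis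
    using that[of n m] scaled[OF zy, of g x] scaled[OF nz(1), of h y]
      scaled[OF \<open>?D x y \<noteq> 0\<close>, of u z] scaled[OF diff(1), of v w] mem
    unfolding sum diff(2) by (simp add: n_def m_def)
qed

text \<open>The vector \<open>cross3 n k\<close> is orthogonal to both normals, and it is nonzero
  because parallel normals define the same line. Hence it spans the meet, and incidence becomes
  membership of a single vector.\<close>

lemma meet_orthogonal_subset_iff:
  fixes n k :: "real ^ 3"
  assumes "n \<noteq> 0" "k \<noteq> 0" and ne: "{v. n \<bullet> v = 0} \<noteq> {v. k \<bullet> v = 0}" and l: "subspace l"
  shows "meet {v. n \<bullet> v = 0} {v. k \<bullet> v = 0} \<subseteq> l \<longleftrightarrow> cross3 n k \<in> l"
proof -
  let ?P = "meet {v. n \<bullet> v = 0} {v. k \<bullet> v = 0}"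
  have P: "proj_point ?P"
    using assms by (intro proj_point_meet proj_line_orthogonal)
  have mem: "cross3 n k \<in> ?P"
    by (simp add: meet_def dot_cross_self)
  have "cross3 n k \<noteq> 0"
  proof
    assume "cross3 n k = 0"
    then obtain c where "k = c *\<^sub>R n"
      using assms by (auto simp: cross_eq_0 collinear_lemma)
    then show False
      using ne \<open>k \<noteq> 0\<close> by auto
  qed
  then have "span {cross3 n k} = ?P"
    using P mem by (intro dim_eq_imp_eq span_minimal) (auto simp: proj_point_def)
  then show ?thesis
    using mem l span_minimal[of "{cross3 n k}" l] by auto
qed

theorem proposition1:
  fixes A1 A2 a11 a12 b11 b12 a21 a22 b21 b22 :: "(real ^ 3) set"
  assumes "harmonic_pencil A1 a11 a12 b11 b12"
    and "harmonic_pencil A2 a21 a22 b21 b22"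
    and "a11 \<noteq> a21" and "a12 \<noteq> a22" and "b11 \<noteq> b21" and "b12 \<noteq> b22"
    and "proj_collinear {meet a11 a21, meet a12 a22, meet b11 b21} \<or>
         proj_collinear {meet a11 a21, meet a12 a22, meet b12 b22} \<or>
         proj_collinear {meet a11 a21, meet b11 b21, meet b12 b22} \<or>
         proj_collinear {meet a12 a22, meet b11 b21, meet b12 b22}"
  shows "proj_collinear {meet a11 a21, meet a12 a22, meet b11 b21, meet b12 b22}"
proof -
  obtain n m where 1: "n \<noteq> 0" "m \<noteq> 0" "n + m \<noteq> 0" "n - m \<noteq> 0"
    "a11 = {x. n \<bullet> x = 0}" "a12 = {x. m \<bullet> x = 0}"
    "b11 = {x. (n + m) \<bullet> x = 0}" "b12 = {x. (n - m) \<bullet> x = 0}"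
    using harmonic_pencil_normals[OF assms(1)] .
  obtain n' m' where 2: "n' \<noteq> 0" "m' \<noteq> 0" "n' + m' \<noteq> 0" "n' - m' \<noteq> 0"
    "a21 = {x. n' \<bullet> x = 0}" "a22 = {x. m' \<bullet> x = 0}"
    "b21 = {x. (n' + m') \<bullet> x = 0}" "b22 = {x. (n' - m') \<bullet> x = 0}"
    using harmonic_pencil_normals[OF assms(2)] .
  define N M X where "N = cross3 n n'" and "M = cross3 m m'" and "X = cross3 n m' + cross3 m n'"
  have plus: "cross3 (n + m) (n' + m') = N + M + X"
    and minus: "cross3 (n - m) (n' - m') = N + M - X"
    by (simp_all add: N_def M_def X_def cross3_simps)
  obtain l where l: "proj_line l" and three:
    "meet a11 a21 \<subseteq> l \<and> meet a12 a22 \<subseteq> l \<and> meet b11 b21 \<subseteq> l \<or>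
     meet a11 a21 \<subseteq> l \<and> meet a12 a22 \<subseteq> l \<and> meet b12 b22 \<subseteq> l \<or>
     meet a11 a21 \<subseteq> l \<and> meet b11 b21 \<subseteq> l \<and> meet b12 b22 \<subseteq> l \<or>
     meet a12 a22 \<subseteq> l \<and> meet b11 b21 \<subseteq> l \<and> meet b12 b22 \<subseteq> l"
    using assms(7) unfolding proj_collinear_def by auto
  have sub: "subspace l"
    using l by (simp add: proj_line_def)
  have iffs: "meet a11 a21 \<subseteq> l \<longleftrightarrow> N \<in> l" "meet a12 a22 \<subseteq> l \<longleftrightarrow> M \<in> l"
    "meet b11 b21 \<subseteq> l \<longleftrightarrow> N + M + X \<in> l" "meet b12 b22 \<subseteq> l \<longleftrightarrow> N + M - X \<in> l"
    using 1 2 assms(3-6) meet_orthogonal_subset_iff[of n n', OF _ _ _ sub]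
      meet_orthogonal_subset_iff[of m m', OF _ _ _ sub]
      meet_orthogonal_subset_iff[of "n + m" "n' + m'", OF _ _ _ sub, unfolded plus]
      meet_orthogonal_subset_iff[of "n - m" "n' - m'", OF _ _ _ sub, unfolded minus]
    unfolding N_def M_def by metis+
  have "N \<in> l \<and> M \<in> l \<and> N + M + X \<in> l \<and> N + M - X \<in> l"
  proof -
    \<comment> \<open>Given \<open>N\<close> and \<open>M\<close>, each of the other two vectors
      determines the other, as they sum to \<open>2 *\<^sub>R (N + M)\<close>.\<close>
    have "N + M - X = N + (M + (N + M)) - (N + M + X)"
      "N + M + X = N + (M + (N + M)) - (N + M - X)"
      by simp_all
    then have "N \<in> l \<Longrightarrow> M \<in> l \<Longrightarrow> N + M + X \<in> l \<longleftrightarrow> N + M - X \<in> l"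
      using sub by (metis subspace_add subspace_diff)
    \<comment> \<open>If instead both vectors with \<open>X\<close> lie in \<open>l\<close>,
      averaging eliminates \<open>X\<close>; then \<open>N\<close> and \<open>M\<close> determine
      each other.\<close>
    moreover have "N + M \<in> l" if "N + M + X \<in> l" "N + M - X \<in> l"
    proof -
      have "(1 / 2) *\<^sub>R ((N + M + X) + (N + M - X)) \<in> l"
        using subspace_scale[OF sub subspace_add[OF sub that]] .
      also have "(N + M + X) + (N + M - X) = 2 *\<^sub>R (N + M)"
        by (simp add: scaleR_2)
      finally show ?thesis by simp
    qed
    moreover have "N + M \<in> l \<Longrightarrow> N \<in> l \<longleftrightarrow> M \<in> l"
      using subspace_diff[OF sub, of "N + M" N] subspace_diff[OF sub, of "N + M" M] by auto
    ultimately show ?thesis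
      using three unfolding iffs by blast
  qed
  then show ?thesis
    using l iffs by (auto simp: proj_collinear_def)
qed

end
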